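(* Let $T$ be a finite tree that is not a path. Then the metric dimension of its line graph satisfies $$\mu(L(T))=\sigma(T)-\mathrm{ex}(T).$$
   Context: The line graph $L(T)$ of $T$ is the graph whose vertices are the edges of $T$, two distinct edges being adjacent in $L(T)$ if and only if they share an endpoint in $T$. For a connected graph $H$, $d_H(u,v)$ is the length of a shortest path between $u$ and $v$. A resolving set of $H$ is a set $W=\{w_1,\ldots,w_m\}$ of vertices such that each vertex $u$ of $H$ is uniquely determined by the vector $(d_H(u,w_1),\ldots,d_H(u,w_m))$, i.e. distinct vertices have distinct vectors. The metric dimension $\mu(H)$ is the minimum cardinality of a resolving set of $H$. Let $T$ be a tree. A vertex of degree 1 in $T$ is called an end-vertex; a vertex of degree at least 3 in $T$ is called a major vertex. An end-vertex $u$ of $T$ is a terminal vertex of a major vertex $v$ of $T$ if $d_T(u,v)<d_T(u,w)$ for every other major vertex $w$ of $T$. A major vertex $v$ is an exterior major vertex of $T$ if there exists a terminal vertex of $v$ in $T$. $\mathrm{EX}(T)$ denotes the set of all exterior major vertices of $T$, and for $v\in\mathrm{EX}(T)$, $\mathrm{TER}(v)$ denotes the set of all terminal vertices of $v$. Set $\sigma(T)=\sum_{v\in\mathrm{EX}(T)}|\mathrm{TER}(v)|$ and $\mathrm{ex}(T)=|\mathrm{EX}(T)|$. *)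

theory Defs
  imports "Graph_Theory.Graph_Theory"
begin

text \<open>
  As in the library, finite simple graphs are loop-free symmetric digraphs without parallel
  arcs (locale \<^locale>\<open>graph\<close>): an edge with endpoints u, v is the pair of opposite arcs
  u to v and v to u.

  The library's \<^const>\<open>tree\<close> is not usable for such graphs: its \<^const>\<open>forest\<close> forbids every directed
  cycle, and the two opposite arcs of an edge already form one.  In a simple symmetric digraph,
  undirected cycles are exactly the directed cycles of length at least 3.
\<close>

definition undirected_tree :: "('a, 'b) pre_digraph \<Rightarrow> bool" where
  "undirected_tree G \<longleftrightarrow> graph G \<and> Digraph_Component.connected G
     \<and> \<not> (\<exists>p. pre_digraph.cycle G p \<and> 3 \<le> length p)"

text \<open>The one-vertex graph counts as a path.\<close>

definition path_graph :: "('a, 'b) pre_digraph \<Rightarrow> bool" where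
  "path_graph G \<longleftrightarrow> (\<exists>p. vpath p G \<and> verts G = set p
     \<and> arcs_ends G = set (vwalk_arcs p) \<union> (set (vwalk_arcs p))\<inverse>)"

definition line_graph :: "('a, 'b) pre_digraph \<Rightarrow> 'a set pair_pre_digraph" where
  "line_graph G =
     (let E = (\<lambda>e. {tail G e, head G e}) ` arcs G
      in \<lparr> pverts = E, parcs = {(e, f). e \<in> E \<and> f \<in> E \<and> e \<noteq> f \<and> e \<inter> f \<noteq> {}} \<rparr>)"

lemma graph_line_graph:
  assumes "graph G"
  shows "graph (with_proj (line_graph G))"
proof -
  interpret graph G by fact
  define E where "E = (\<lambda>e. {tail G e, head G e}) ` arcs G"
  have L: "line_graph G = \<lparr> pverts = E, parcs = {(e, f). e \<in> E \<and> f \<in> E \<and> e \<noteq> f \<and> e \<inter> f \<noteq> {}} \<rparr>"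
    by (simp add: line_graph_def E_def Let_def)
  have "finite E" by (simp add: E_def)
  then have "finite (E \<times> E)" by simp
  moreover have "parcs (line_graph G) \<subseteq> E \<times> E" by (auto simp: L)
  ultimately have "finite (parcs (line_graph G))" by (rule rev_finite_subset)
  with \<open>finite E\<close> have "pair_graph (line_graph G)"
    by unfold_locales (auto simp: L symmetric_def intro!: symI)
  then show ?thesis by (rule pair_graph.pair_graphD_graph)
qed

text \<open>The shortest-path distance of the library, every arc having weight 1.\<close>

definition graph_dist :: "('a, 'b) pre_digraph \<Rightarrow> 'a \<Rightarrow> 'a \<Rightarrow> ereal" where
  "graph_dist G u v = wf_digraph.\<mu> G (\<lambda>_. 1) u v"

definition resolving_set :: "('a, 'b) pre_digraph \<Rightarrow> 'a set \<Rightarrow> bool" where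
  "resolving_set H W \<longleftrightarrow> finite W \<and> W \<subseteq> verts H \<and>
     (\<forall>u\<in>verts H. \<forall>v\<in>verts H. (\<forall>w\<in>W. graph_dist H u w = graph_dist H v w) \<longrightarrow> u = v)"

definition metric_dimension :: "('a, 'b) pre_digraph \<Rightarrow> nat" where
  "metric_dimension H = (LEAST k. \<exists>W. resolving_set H W \<and> card W = k)"

text \<open>
  In a simple symmetric digraph, \<^const>\<open>out_degree\<close> is the degree in the undirected sense.
\<close>

definition end_vertex :: "('a, 'b) pre_digraph \<Rightarrow> 'a \<Rightarrow> bool" where
  "end_vertex T u \<longleftrightarrow> u \<in> verts T \<and> out_degree T u = 1"

definition major_vertex :: "('a, 'b) pre_digraph \<Rightarrow> 'a \<Rightarrow> bool" where
  "major_vertex T v \<longleftrightarrow> v \<in> verts T \<and> 3 \<le> out_degree T v"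

definition terminal_vertex :: "('a, 'b) pre_digraph \<Rightarrow> 'a \<Rightarrow> 'a \<Rightarrow> bool" where
  "terminal_vertex T v u \<longleftrightarrow> major_vertex T v \<and> end_vertex T u \<and>
     (\<forall>w. major_vertex T w \<and> w \<noteq> v \<longrightarrow> graph_dist T u v < graph_dist T u w)"

definition TER :: "('a, 'b) pre_digraph \<Rightarrow> 'a \<Rightarrow> 'a set" where
  "TER T v = {u. terminal_vertex T v u}"

definition EX_major :: "('a, 'b) pre_digraph \<Rightarrow> 'a set" where
  "EX_major T = {v. major_vertex T v \<and> (\<exists>u. terminal_vertex T v u)}"

definition sigma :: "('a, 'b) pre_digraph \<Rightarrow> nat" where
  "sigma T = (\<Sum>v\<in>EX_major T. card (TER T v))"

definition ex_count :: "('a, 'b) pre_digraph \<Rightarrow> nat" where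
  "ex_count T = card (EX_major T)"

end

theory Submission
  imports Defs
begin

text \<open>
  The leg of a terminal vertex $u$ of $v$ is the geodesic from $u$ to $v$ without $v$.  An edge
  not meeting two legs at $v$ sees the first edges of both legs at the same distance, so a
  resolving set misses at most one leg at each exterior major vertex; legs are so far apart that
  no edge meets two of them.  This gives the lower bound.

  Conversely, let $S$ contain all terminal vertices but one for each exterior major vertex; the
  pendant edges at $S$ resolve.  If $ab$ and $cg$, with $b$ and $c$ the endpoints
  facing each other, were not separated, then the components beyond $a$ and beyond $g$ would
  contain no vertex of $S$, hence no major vertex: they lie in omitted legs of distinct major
  vertices $v$ and $w$ between $b$ and $c$.  A vertex of $S$ in a further branch at $v$ gives
  $d(v,b) = d(v,c)$, one at $w$ gives $d(w,b) = d(w,c)$, and together these force $v = w$.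
\<close>

text \<open>The last assumption says that no cycle passes through the arcs from a to x and from a to y.\<close>

locale tree_relation =
  fixes V :: "'a set" and E :: "'a rel"
  assumes finite_V: "finite V"
    and V_nonempty: "V \<noteq> {}"
    and E_sub: "E \<subseteq> V \<times> V"
    and E_sym: "sym E"
    and E_irrefl: "irrefl E"
    and E_connected: "\<And>x y. x \<in> V \<Longrightarrow> y \<in> V \<Longrightarrow> (x, y) \<in> E\<^sup>*"
    and E_acyclic: "\<And>a x y. (a, x) \<in> E \<Longrightarrow> (a, y) \<in> E \<Longrightarrow>
      (x, y) \<in> (E \<inter> (- {a}) \<times> (- {a}))\<^sup>* \<Longrightarrow> x = y"
begin

section \<open>Distances in a tree, measured along the edge relation\<close>

definition d :: "'a \<Rightarrow> 'a \<Rightarrow> nat" where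
  "d x y = (LEAST n. (x, y) \<in> E ^^ n)"

lemma E_in_V: "(x, y) \<in> E \<Longrightarrow> x \<in> V" "(x, y) \<in> E \<Longrightarrow> y \<in> V"
  using E_sub by auto

lemma E_commute: "(x, y) \<in> E \<Longrightarrow> (y, x) \<in> E"
  using E_sym by (auto dest: symD)

lemma E_neq: "(x, y) \<in> E \<Longrightarrow> x \<noteq> y"
  using E_irrefl by (auto simp: irrefl_def)

lemma d_relpow: assumes "x \<in> V" "y \<in> V" shows "(x, y) \<in> E ^^ d x y"
proof -
  obtain n where "(x, y) \<in> E ^^ n"
    using E_connected[OF assms] by (auto simp: rtrancl_power)
  then show ?thesis unfolding d_def by (rule LeastI)
qed

lemma d_le: "(x, y) \<in> E ^^ n \<Longrightarrow> d x y \<le> n"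
  unfolding d_def by (rule Least_le)

lemma d_self [simp]: "d x x = 0"
  using d_le[of x x 0] by simp

lemma d_eq_0: "x \<in> V \<Longrightarrow> y \<in> V \<Longrightarrow> d x y = 0 \<longleftrightarrow> x = y"
  using d_relpow[of x y] by auto

lemma d_triangle:
  assumes "x \<in> V" "y \<in> V" "z \<in> V" shows "d x z \<le> d x y + d y z"
  using d_relpow[OF assms(1,2)] d_relpow[OF assms(2,3)]
  by (intro d_le) (auto simp: relpow_add)

lemma relpow_E_sym: "(x, y) \<in> E ^^ n \<Longrightarrow> (y, x) \<in> E ^^ n"
proof (induction n arbitrary: y)
  case (Suc n)
  then obtain z where "(x, z) \<in> E ^^ n" "(z, y) \<in> E" by auto
  then show ?case using Suc.IH E_commute relpow_Suc_I2 by metis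
qed simp

lemma d_sym: "x \<in> V \<Longrightarrow> y \<in> V \<Longrightarrow> d x y = d y x"
  by (simp add: antisym d_le d_relpow relpow_E_sym)

lemma d_edge: assumes "(x, y) \<in> E" shows "d x y = 1"
proof -
  have "d x y \<le> 1" using assms by (intro d_le) simp
  moreover have "d x y \<noteq> 0" using assms d_eq_0 E_in_V E_neq by blast
  ultimately show ?thesis by simp
qed

lemma d_edge_le:
  assumes "(x, y) \<in> E" "z \<in> V" shows "d x z \<le> Suc (d y z)"
  using d_triangle[of x y z] d_edge[OF assms(1)] E_in_V[OF assms(1)] assms(2) by simp

lemma d_step:
  assumes "x \<in> V" "y \<in> V" "x \<noteq> y"
  obtains x' where "(x, x') \<in> E" "d x y = Suc (d x' y)"
proof -
  obtain n where n: "d x y = Suc n" using assms d_eq_0 by (cases "d x y") auto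
  then have "(x, y) \<in> E ^^ Suc n" using d_relpow[OF assms(1,2)] by simp
  then obtain x' where x': "(x, x') \<in> E" "(x', y) \<in> E ^^ n" by (blast dest: relpow_Suc_D2)
  then have "d x' y \<le> n" by (simp add: d_le)
  moreover have "d x y \<le> Suc (d x' y)" using x' assms d_edge_le by blast
  ultimately show thesis using that x' n by simp
qed

section \<open>Uniqueness of geodesics\<close>

text \<open>After \<open>x\<close>, a shortest path to \<open>r\<close> meets only vertices strictly
  closer to \<open>r\<close>. If \<open>a\<close> is neither \<open>x\<close> nor one of these, the
  path survives the deletion of \<open>a\<close>, which is the shape that \<open>E_acyclic\<close>
  asks for.\<close>

lemma closer_connected:
  assumes "x \<in> V" "r \<in> V"
    and avoid: "\<And>z. z \<in> V \<Longrightarrow> d z r < d x r \<Longrightarrow> z \<noteq> a" "x \<noteq> a"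
  shows "(x, r) \<in> (E \<inter> (- {a}) \<times> (- {a}))\<^sup>*"
  using assms
proof (induction "d x r" arbitrary: x)
  case 0
  then show ?case using d_eq_0 by simp
next
  case (Suc n)
  then have "x \<noteq> r" by auto
  then obtain x' where x': "(x, x') \<in> E" "d x r = Suc (d x' r)"
    using d_step Suc.prems by metis
  have "x' \<in> V" using x' E_in_V by blast
  have "x' \<noteq> a" using x' Suc.prems \<open>x' \<in> V\<close> by simp
  have "(x', r) \<in> (E \<inter> (- {a}) \<times> (- {a}))\<^sup>*"
    using Suc.hyps(1)[of x'] Suc.hyps(2) x' Suc.prems \<open>x' \<in> V\<close> \<open>x' \<noteq> a\<close> by simp
  then show ?case using x' \<open>x' \<noteq> a\<close> Suc.prems(4)
    by (intro converse_rtrancl_into_rtrancl[of x x']) auto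
qed

lemma avoiding_sym:
  "(x, y) \<in> (E \<inter> (- {a}) \<times> (- {a}))\<^sup>* \<Longrightarrow> (y, x) \<in> (E \<inter> (- {a}) \<times> (- {a}))\<^sup>*"
proof -
  have "sym (E \<inter> (- {a}) \<times> (- {a}))" using E_sym by (auto simp: sym_def)
  then show "(x, y) \<in> (E \<inter> (- {a}) \<times> (- {a}))\<^sup>* \<Longrightarrow> (y, x) \<in> (E \<inter> (- {a}) \<times> (- {a}))\<^sup>*"
    by (meson sym_rtrancl symD)
qed

text \<open>Both neighbours reach \<open>r\<close> without using \<open>a\<close>, so if they were
  distinct, a cycle would pass through \<open>a\<close>.\<close>

lemma closer_neighbour_unique:
  assumes "(a, x) \<in> E" "(a, y) \<in> E" "r \<in> V" "d a r = Suc (d x r)" "d a r = Suc (d y r)"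
  shows "x = y"
proof -
  have "(x, r) \<in> (E \<inter> (- {a}) \<times> (- {a}))\<^sup>*" "(y, r) \<in> (E \<inter> (- {a}) \<times> (- {a}))\<^sup>*"
    using assms E_in_V E_neq by (auto intro!: closer_connected)
  then show ?thesis using E_acyclic[OF assms(1,2)] avoiding_sym rtrancl_trans by metis
qed

text \<open>Trees are bipartite. In case of a tie, \<open>b\<close> and the neighbour
  \<open>x\<close> of \<open>a\<close> closer to \<open>r\<close> would be joined through
  \<open>r\<close> without using \<open>a\<close>, so \<open>x = b\<close>, although
  \<open>x\<close> is closer to \<open>r\<close> than \<open>b\<close>.\<close>

lemma edge_d_neq:
  assumes "(a, b) \<in> E" "r \<in> V" shows "d a r \<noteq> d b r"
proof
  assume eq: "d a r = d b r"
  have V: "a \<in> V" "b \<in> V" using assms E_in_V by auto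
  then have "a \<noteq> r" using eq assms d_eq_0[of b r] E_neq by auto
  then obtain x where x: "(a, x) \<in> E" "d a r = Suc (d x r)" using d_step V assms by metis
  have "(x, r) \<in> (E \<inter> (- {a}) \<times> (- {a}))\<^sup>*" "(b, r) \<in> (E \<inter> (- {a}) \<times> (- {a}))\<^sup>*"
    using assms x V eq E_in_V[OF x(1)] E_neq[OF x(1)] E_neq[OF assms(1)]
    by (auto intro!: closer_connected)
  then have "x = b" using E_acyclic[OF x(1) assms(1)] avoiding_sym rtrancl_trans by metis
  then show False using x eq by simp
qed

lemma edge_d_cases:
  assumes "(a, b) \<in> E" "r \<in> V"
  shows "d a r = Suc (d b r) \<or> d b r = Suc (d a r)"
  using d_edge_le[OF assms] d_edge_le[OF E_commute[OF assms(1)] assms(2)] edge_d_neq[OF assms]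
  by linarith

text \<open>A geodesic arriving at \<open>b\<close> through \<open>a\<close> and one leaving
  \<open>b\<close> away from \<open>a\<close> concatenate to a geodesic. The induction is on the
  length of the second one; \<open>c'\<close> is the vertex before its endpoint
  \<open>c\<close>.\<close>

lemma glue:
  assumes "(a, b) \<in> E" "u \<in> V" "c \<in> V"
    and "d u b = Suc (d u a)" "d a c = Suc (d b c)"
  shows "d u c = d u b + d b c"
  using assms(3,5)
proof (induction "d b c" arbitrary: c rule: less_induct)
  case less
  have V: "a \<in> V" "b \<in> V" using assms(1) E_in_V by auto
  show ?case
  proof (cases "c = b")
    case True then show ?thesis by simp
  next
    case False
    then obtain c' where c': "(c, c') \<in> E" "d c b = Suc (d c' b)"
      using d_step less.prems V by metis
    have V': "c' \<in> V" using c' E_in_V by auto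
    have bc: "d b c = Suc (d b c')" using c' d_sym V V' less.prems by simp
    have ac': "d a c' = Suc (d b c')"
      using d_edge_le[OF c'(1) V(1)] d_edge_le[OF assms(1) V'] bc less.prems d_sym V V' by simp
    have uc': "d u c' = d u b + d b c'" using less.hyps[of c'] bc V' ac' by simp
    \<comment> \<open>\<open>z\<close> is the vertex before \<open>c'\<close> on the concatenated
      route: \<open>a\<close> if \<open>c' = b\<close>, and otherwise the next vertex from
      \<open>c'\<close> towards \<open>b\<close>.\<close>
    obtain z where z: "(c', z) \<in> E" "d c' a = Suc (d z a)" "d c' u = Suc (d z u)"
    proof (cases "c' = b")
      case True
      show thesis
      proof (rule that[of a])
        show "(c', a) \<in> E" using True E_commute[OF assms(1)] by simp
        show "d c' a = Suc (d a a)" using True d_edge[OF E_commute[OF assms(1)]] by simp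
        show "d c' u = Suc (d a u)" using True assms(2,4) d_sym V by metis
      qed
    next
      case False
      obtain z where z: "(c', z) \<in> E" "d c' b = Suc (d z b)" using d_step[OF V'(1) V(2) False] .
      have zV: "z \<in> V" using z E_in_V by auto
      have sym: "d z b = d b z" "d c' b = d b c'" "d z a = d a z" "d c' a = d a c'"
        "d c' u = d u c'" "d z u = d u z"
        using d_sym V V' zV assms(2) by auto
      have az: "d a z = Suc (d b z)"
        using d_edge_le[OF z(1) V(1)] d_edge_le[OF assms(1) zV] ac' z(2) sym by simp
      have "d u z = d u b + d b z" using less.hyps[of z] zV az bc z(2) sym by simp
      then show thesis using that[of z] z az uc' ac' sym by simp
    qed
    \<comment> \<open>Being farther from \<open>a\<close> than \<open>c'\<close>, the vertex
      \<open>c\<close> is not \<open>z\<close>; as \<open>z\<close> is the only neighbour of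
      \<open>c'\<close> closer to \<open>u\<close>, the step from \<open>c'\<close> to
      \<open>c\<close> leads away from \<open>u\<close>.\<close>
    have "d c a = Suc (d c' a)" using less.prems ac' bc d_sym V V' by simp
    then have "z \<noteq> c" using z(2) by auto
    then have "d c' u \<noteq> Suc (d c u)"
      using closer_neighbour_unique[OF z(1) E_commute[OF c'(1)] assms(2) z(3)] by auto
    then have "d c u = Suc (d c' u)" using edge_d_cases[OF c'(1) assms(2)] by simp
    then show ?thesis using uc' bc d_sym assms less.prems V' by simp
  qed
qed

section \<open>Degrees and branches\<close>

definition deg :: "'a \<Rightarrow> nat" where "deg x = card (E `` {x})"

text \<open>For an edge from \<open>x\<close> to \<open>y\<close> this is the component of
  \<open>y\<close> after the deletion of \<open>x\<close>, expressed by distances alone.\<close>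

definition branch :: "'a \<Rightarrow> 'a \<Rightarrow> 'a set" where
  "branch x y = {z \<in> V. d z x = Suc (d z y)}"

lemma branch_self: "(x, y) \<in> E \<Longrightarrow> y \<in> branch x y"
  using E_in_V d_edge[of y x] E_commute by (auto simp: branch_def)

lemma not_branch:
  assumes "(x, y) \<in> E" "z \<in> V" "z \<notin> branch x y"
  shows "d z y = Suc (d z x)" "d y z = Suc (d x z)"
  using edge_d_cases[OF assms(1,2)] assms E_in_V[OF assms(1)] d_sym by (auto simp: branch_def)

text \<open>Every way out of the branch leads through \<open>x\<close>: outside it, \<open>x\<close>
  is closer than \<open>y\<close>, so \<open>glue\<close> applies to the edge from \<open>y\<close>
  to \<open>x\<close>.\<close>

lemma branch_separates:
  assumes "(x, y) \<in> E" "u \<in> branch x y" "c \<in> V" "c \<notin> branch x y"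
  shows "d u c = d u x + d x c"
  using glue[of y x u c] not_branch[OF assms(1,3,4)] assms E_commute by (auto simp: branch_def)

lemma finite_neighbours: "finite (E `` {x})"
  using finite_V E_sub by (auto intro: finite_subset)

text \<open>All neighbours of \<open>z\<close> are then closer to \<open>x\<close>, and there is
  only one such neighbour.\<close>

lemma degree_oneI:
  assumes "z \<in> V" "x \<in> V" "z \<noteq> x"
    and "\<And>t. (z, t) \<in> E \<Longrightarrow> d t x \<noteq> Suc (d z x)"
  shows "deg z = 1"
proof -
  obtain y where y: "(z, y) \<in> E" "d z x = Suc (d y x)" using d_step[OF assms(1-3)] .
  have "t = y" if "(z, t) \<in> E" for t
    using edge_d_cases[OF that assms(2)] assms(4)[OF that] closer_neighbour_unique[OF that y(1) assms(2)] y(2)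
    by metis
  then have "E `` {z} = {y}" using y(1) by blast
  then show ?thesis by (simp add: deg_def)
qed

text \<open>A vertex of the branch farthest from \<open>x\<close> will do: a neighbour still farther
  away would again lie in the branch.\<close>

lemma branch_has_end:
  assumes "(x, y) \<in> E"
  obtains l where "l \<in> branch x y" "deg l = 1"
proof -
  have V: "x \<in> V" "y \<in> V" using assms E_in_V by auto
  have "finite (branch x y)" using finite_V by (simp add: branch_def)
  moreover have "branch x y \<noteq> {}" using branch_self[OF assms] by auto
  ultimately obtain l where l: "l \<in> branch x y" and max: "\<And>z. z \<in> branch x y \<Longrightarrow> d z x \<le> d l x"
    using finite_has_maximal[of "(\<lambda>z. d z x) ` branch x y"] by fastforce
  have lV: "l \<in> V" "d l x = Suc (d l y)" using l by (auto simp: branch_def)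
  have "deg l = 1"
  proof (rule degree_oneI[OF lV(1) V(1)])
    show "l \<noteq> x" using lV by auto
    fix t assume t: "(l, t) \<in> E"
    show "d t x \<noteq> Suc (d l x)"
    proof
      assume eq: "d t x = Suc (d l x)"
      have "d t x \<le> Suc (d t y)" using d_edge_le[OF assms] d_sym t E_in_V V by metis
      moreover have "d t y \<le> Suc (d l y)" using d_edge_le[OF E_commute[OF t] V(2)] .
      ultimately have "t \<in> branch x y" using eq lV t E_in_V by (auto simp: branch_def)
      then show False using max eq by fastforce
    qed
  qed
  then show thesis using l that by blast
qed

section \<open>Major vertices, end-vertices and terminal vertices\<close>

definition major :: "'a \<Rightarrow> bool" where "major x \<longleftrightarrow> x \<in> V \<and> 3 \<le> deg x"

definition endv :: "'a \<Rightarrow> bool" where "endv x \<longleftrightarrow> x \<in> V \<and> deg x = 1"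

definition terminal :: "'a \<Rightarrow> 'a \<Rightarrow> bool" where
  "terminal v u \<longleftrightarrow> major v \<and> endv u \<and> (\<forall>w. major w \<and> w \<noteq> v \<longrightarrow> d u v < d u w)"

lemma major_V: "major x \<Longrightarrow> x \<in> V"
  by (simp add: major_def)

lemma endv_V: "endv x \<Longrightarrow> x \<in> V"
  by (simp add: endv_def)

lemma terminal_V: "terminal v u \<Longrightarrow> v \<in> V" "terminal v u \<Longrightarrow> u \<in> V"
  by (simp_all add: terminal_def major_V endv_V)

lemma terminal_neq: "terminal v u \<Longrightarrow> u \<noteq> v"
  by (auto simp: terminal_def major_def endv_def)

lemma card_le_deg: "A \<subseteq> E `` {x} \<Longrightarrow> card A \<le> deg x"
  unfolding deg_def by (rule card_mono[OF finite_neighbours])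

lemma endv_neighbour_unique:
  assumes "endv u" "(u, x) \<in> E" "(u, y) \<in> E" shows "x = y"
proof (rule ccontr)
  assume "x \<noteq> y"
  then have "card {x, y} = 2" by simp
  moreover have "card {x, y} \<le> deg u" using assms by (intro card_le_deg) auto
  ultimately show False using assms by (simp add: endv_def)
qed

text \<open>The geodesics from an end-vertex to two vertices can only part at a major vertex.\<close>

lemma geodesics_from_end:
  assumes "endv u" "v \<in> V" "x \<in> V"
  shows "d u v = d u x + d x v \<or> d u x = d u v + d v x \<or>
    (\<exists>m. major m \<and> d u v = d u m + d m v \<and> m \<noteq> v)"
proof -
  \<comment> \<open>\<open>M\<close> is the common part of the two geodesics from \<open>u\<close>;
    its element \<open>m\<close> farthest from \<open>u\<close> is where they part.\<close>
  define M where "M = {m \<in> V. d u v = d u m + d m v \<and> d u x = d u m + d m x}"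
  have u: "u \<in> V" using assms endv_V by simp
  have "finite M" "u \<in> M" using finite_V u by (auto simp: M_def)
  then obtain m where m: "m \<in> M" and max: "\<And>z. z \<in> M \<Longrightarrow> d u z \<le> d u m"
    using finite_has_maximal[of "d u ` M"] by fastforce
  have mV: "m \<in> V" "d u v = d u m + d m v" "d u x = d u m + d m x" using m by (auto simp: M_def)
  show ?thesis
  proof (cases "m = v \<or> m = x")
    case True then show ?thesis using mV by auto
  next
    case False
    obtain m1 where m1: "(m, m1) \<in> E" "d m v = Suc (d m1 v)"
      using d_step[OF mV(1) assms(2)] False by auto
    obtain m2 where m2: "(m, m2) \<in> E" "d m x = Suc (d m2 x)"
      using d_step[OF mV(1) assms(3)] False by auto
    have V12: "m1 \<in> V" "m2 \<in> V" using m1 m2 E_in_V by auto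
    have le: "d u m1 \<le> Suc (d u m)" "d u m2 \<le> Suc (d u m)"
      using d_edge_le[OF E_commute[OF m1(1)] u] d_edge_le[OF E_commute[OF m2(1)] u] d_sym u mV(1) V12
      by auto
    have um: "d u m1 = Suc (d u m)" "d u m2 = Suc (d u m)"
      using d_triangle[OF u V12(1) assms(2)] d_triangle[OF u V12(2) assms(3)] le m1 m2 mV by auto
    have ne: "m1 \<noteq> m2"
    proof
      assume "m1 = m2"
      then have "m1 \<in> M" using V12 um m1 m2 mV by (simp add: M_def)
      then show False using max um by fastforce
    qed
    have mu: "m \<noteq> u" using endv_neighbour_unique[OF assms(1)] m1 m2 ne by blast
    \<comment> \<open>The step back towards \<open>u\<close> supplies the third neighbour of
      \<open>m\<close>, besides the first steps \<open>m1\<close> and \<open>m2\<close> of the two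
      continuations.\<close>
    obtain m0 where m0: "(m, m0) \<in> E" "d m u = Suc (d m0 u)" using d_step[OF mV(1) u mu] .
    have "d u m = Suc (d u m0)" using m0 E_in_V[OF m0(1)] d_sym u by simp
    then have "m0 \<noteq> m1" "m0 \<noteq> m2" using um by auto
    then have "card {m0, m1, m2} = 3" using ne by simp
    moreover have "card {m0, m1, m2} \<le> deg m" using m0 m1 m2 by (intro card_le_deg) auto
    ultimately have "major m" using mV by (simp add: major_def)
    then show ?thesis using mV False by blast
  qed
qed

text \<open>The third case of \<open>geodesics_from_end\<close> disappears: a major vertex before
  \<open>v\<close> would be at least as close to \<open>u\<close> as \<open>v\<close>.\<close>

lemma terminal_geodesic:
  assumes "terminal v u" "x \<in> V"
  shows "d u v = d u x + d x v \<or> d u x = d u v + d v x"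
  using geodesics_from_end[of u v x] assms terminal_V[OF assms(1)]
  by (fastforce simp: terminal_def)

lemma terminal_major:
  assumes "terminal v u" "major w" shows "d u w = d u v + d v w"
proof (cases "w = v")
  case False
  then have "d u v < d u w" using assms by (auto simp: terminal_def)
  then show ?thesis using terminal_geodesic[OF assms(1) major_V[OF assms(2)]] by simp
qed simp

lemma terminal_unique: "terminal v u \<Longrightarrow> terminal w u \<Longrightarrow> v = w"
  by (metis terminal_def less_asym)

text \<open>A nearest major vertex is strictly nearest: in case of a tie, the two geodesics from
  \<open>u\<close> would part at a major vertex that is closer still.\<close>

lemma terminal_exists:
  assumes "endv u" "major w" obtains v where "terminal v u"
proof -
  have "finite {v. major v}" using finite_V by (auto intro: finite_subset simp: major_def)
  then obtain v where v: "major v" and min: "\<And>z. major z \<Longrightarrow> d u v \<le> d u z"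
    using assms(2) finite_has_minimal[of "d u ` {v. major v}"] by fastforce
  have pos: "d m z > 0" if "major m" "major z" "m \<noteq> z" for m z
    using that d_eq_0 major_V by blast
  have "d u v < d u z" if z: "major z" "z \<noteq> v" for z
  proof -
    have "\<not> (\<exists>m. major m \<and> d u v = d u m + d m v \<and> m \<noteq> v)"
      using min pos v by (metis less_add_same_cancel1 not_le)
    then consider "d u v = d u z + d z v" | "d u z = d u v + d v z"
      using geodesics_from_end[OF assms(1) major_V[OF v] major_V[OF z(1)]] by blast
    then show ?thesis
      using min[OF z(1)] pos[OF z(1) v z(2)] pos[OF v z(1)] z(2) by cases auto
  qed
  then show thesis using that v assms by (auto simp: terminal_def)
qed

text \<open>Otherwise \<open>u'\<close> would be an inner vertex of the geodesic from
  \<open>u\<close> to \<open>v\<close>; but its only neighbour cannot be closer to both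
  \<open>u\<close> and \<open>v\<close>.\<close>

lemma terminal_to_end:
  assumes "terminal v u" "endv u'" "u \<noteq> u'"
  shows "d u u' = d u v + d v u'"
proof (rule ccontr)
  have V: "u \<in> V" "v \<in> V" "u' \<in> V" using assms terminal_V endv_V by auto
  assume "d u u' \<noteq> d u v + d v u'"
  then have on: "d u v = d u u' + d u' v" using terminal_geodesic[OF assms(1) V(3)] by simp
  have "u' \<noteq> v" using assms by (auto simp: terminal_def major_def endv_def)
  then obtain y where y: "(u', y) \<in> E" "d u' v = Suc (d y v)" using d_step[OF V(3,2)] by auto
  obtain z where z: "(u', z) \<in> E" "d u' u = Suc (d z u)" using d_step[OF V(3,1)] assms(3) by auto
  have "z = y" using endv_neighbour_unique[OF assms(2)] y z by blast
  then show False
    using d_triangle[OF V(1) _ V(2), of y] on y z d_sym V E_in_V[OF y(1)] by simp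
qed

section \<open>Legs\<close>

definition leg :: "'a \<Rightarrow> 'a \<Rightarrow> 'a set" where
  "leg v u = {x \<in> V. x \<noteq> v \<and> d u v = d u x + d x v}"

text \<open>The geodesic from \<open>u\<close> to \<open>u'\<close> passes through \<open>v\<close>
  and \<open>v'\<close>, whence \<open>d x y\<close> is at least
  \<open>d x v + d v' v + d y v'\<close>, whose outer terms are positive. Thus no edge meets both
  legs, even if \<open>v = v'\<close>.\<close>

lemma legs_apart:
  assumes "terminal v u" "terminal v' u'" "u \<noteq> u'" "x \<in> leg v u" "y \<in> leg v' u'"
  shows "1 < d x y"
proof -
  have V: "u \<in> V" "v \<in> V" "u' \<in> V" "v' \<in> V" "x \<in> V" "y \<in> V"
    using assms terminal_V by (auto simp: leg_def)
  have "d u u' = d u v + d v u'" using terminal_to_end[OF assms(1) _ assms(3)] assms(2) by (simp add: terminal_def)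
  moreover have "d u u' \<le> d u x + d x u'" "d x u' \<le> d x y + d y u'"
    using V by (simp_all add: d_triangle)
  moreover have "d u v = d u x + d x v" "d u' v' = d u' y + d y v'" using assms by (auto simp: leg_def)
  moreover have "d x v \<noteq> 0" "d y v' \<noteq> 0" using assms d_eq_0 V by (auto simp: leg_def)
  moreover have "d u' v = d u' v' + d v' v" using terminal_major[OF assms(2)] assms(1) by (simp add: terminal_def)
  moreover have "d u' v = d v u'" "d u' y = d y u'" using d_sym V by auto
  ultimately show ?thesis by linarith
qed

lemma not_leg:
  assumes "terminal v u" "x \<in> V" "x \<notin> leg v u" shows "d u x = d u v + d v x"
  using terminal_geodesic[OF assms(1,2)] assms by (auto simp: leg_def)

section \<open>Edges and their distance in the line graph\<close>

definition edges :: "'a set set" where "edges = (\<lambda>(x, y). {x, y}) ` E"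

definition gap :: "'a set \<Rightarrow> 'a set \<Rightarrow> nat" where
  "gap e f = (LEAST n. \<exists>x\<in>e. \<exists>y\<in>f. d x y = n)"

text \<open>The distance in the line graph.\<close>

definition ld :: "'a set \<Rightarrow> 'a set \<Rightarrow> nat" where
  "ld e f = (if e = f then 0 else Suc (gap e f))"

lemma edgesE:
  assumes "e \<in> edges" "a \<in> e" obtains b where "e = {a, b}" "(a, b) \<in> E"
  using assms E_commute by (fastforce simp: edges_def)

lemma edgesI: "(a, b) \<in> E \<Longrightarrow> {a, b} \<in> edges"
  by (auto simp: edges_def)

lemma edges_V: "e \<in> edges \<Longrightarrow> x \<in> e \<Longrightarrow> x \<in> V"
  using E_in_V by (auto simp: edges_def)

lemma edges_ne: "e \<in> edges \<Longrightarrow> e \<noteq> {}"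
  by (auto simp: edges_def)

lemma edges_diam: "e \<in> edges \<Longrightarrow> x \<in> e \<Longrightarrow> y \<in> e \<Longrightarrow> d x y \<le> 1"
  by (erule edgesE[of _ x]) (auto simp: d_edge)

lemma finite_edges: "finite edges"
  unfolding edges_def using finite_subset[OF E_sub] finite_V by simp

lemma gap_le: "x \<in> e \<Longrightarrow> y \<in> f \<Longrightarrow> gap e f \<le> d x y"
  unfolding gap_def by (rule Least_le) auto

lemma gap_attained:
  assumes "e \<in> edges" "f \<in> edges"
  obtains x y where "x \<in> e" "y \<in> f" "gap e f = d x y"
proof -
  have "\<exists>n. \<exists>x\<in>e. \<exists>y\<in>f. d x y = n" using assms edges_ne by blast
  then have "\<exists>x\<in>e. \<exists>y\<in>f. d x y = gap e f" unfolding gap_def by (rule LeastI_ex)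
  then show thesis using that by metis
qed

text \<open>Passing from the common endpoint to the endpoint of \<open>f\<close> nearest to
  \<open>w\<close> costs at most one step. With \<open>ld_step\<close>, this is what
  \<open>graph_dist_eqI\<close> needs to identify \<open>ld\<close> with the distance in the line
  graph.\<close>

lemma ld_lipschitz:
  assumes "e \<in> edges" "f \<in> edges" "w \<in> edges" "e \<inter> f \<noteq> {}"
  shows "ld e w \<le> Suc (ld f w)"
proof (cases "f = w")
  case True
  obtain x where "x \<in> e" "x \<in> f" using assms by auto
  then have "gap e w = 0" using gap_le[of x e x w] True by simp
  then show ?thesis by (simp add: ld_def)
next
  case False
  obtain x where x: "x \<in> e" "x \<in> f" using assms by auto
  obtain y z where yz: "y \<in> f" "z \<in> w" "gap f w = d y z" using gap_attained assms by metis
  have "gap e w \<le> d x z" using gap_le x yz by simp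
  also have "\<dots> \<le> d x y + d y z" using d_triangle edges_V assms x yz by simp
  also have "\<dots> \<le> 1 + gap f w" using edges_diam[of f x y] assms x yz by simp
  finally show ?thesis using False by (simp add: ld_def)
qed

text \<open>If \<open>e\<close> and \<open>w\<close> touch, move to \<open>w\<close> itself;
  otherwise move to the first edge of a shortest path between them.\<close>

lemma ld_step:
  assumes "e \<in> edges" "w \<in> edges" "e \<noteq> w"
  obtains f where "f \<in> edges" "f \<noteq> e" "e \<inter> f \<noteq> {}" "ld e w = Suc (ld f w)"
proof -
  obtain x z where xz: "x \<in> e" "z \<in> w" "gap e w = d x z" using gap_attained assms by metis
  show thesis
  proof (cases "x = z")
    case True
    then show thesis using that[of w] xz assms by (auto simp: ld_def)
  next
    case False
    have V: "x \<in> V" "z \<in> V" using xz assms edges_V by auto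
    obtain x' where x': "(x, x') \<in> E" "d x z = Suc (d x' z)" using d_step[OF V False] .
    let ?f = "{x, x'}"
    have f: "?f \<in> edges" using x' edgesI by simp
    \<comment> \<open>\<open>x'\<close> is closer to \<open>z\<close> than the gap allows for an
      endpoint of \<open>e\<close>.\<close>
    have "x' \<notin> e" using gap_le[of x' e z w] xz x' by auto
    then have ne: "?f \<noteq> e" by auto
    have "ld ?f w \<le> Suc (gap ?f w)" by (simp add: ld_def)
    also have "gap ?f w \<le> d x' z" using gap_le xz by simp
    finally have "Suc (ld ?f w) \<le> ld e w" using assms xz x' by (simp add: ld_def)
    moreover have "ld e w \<le> Suc (ld ?f w)" using ld_lipschitz[OF assms(1) f assms(2)] xz by auto
    ultimately show thesis using that[OF f ne] xz by auto
  qed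
qed

section \<open>The lower bound\<close>

definition resolves :: "'a set set \<Rightarrow> bool" where
  "resolves W \<longleftrightarrow> W \<subseteq> edges \<and>
     (\<forall>e\<in>edges. \<forall>f\<in>edges. (\<forall>w\<in>W. ld e w = ld f w) \<longrightarrow> e = f)"

lemma first_leg_edge:
  assumes "terminal v u"
  obtains y where "(v, y) \<in> E" "y \<in> leg v u" "d u v = Suc (d u y)"
proof -
  have V: "v \<in> V" "u \<in> V" using assms terminal_V by auto
  obtain y where y: "(v, y) \<in> E" "d v u = Suc (d y u)"
    using d_step[OF V] terminal_neq[OF assms] by metis
  have "y \<in> V" using y E_in_V by simp
  then show thesis
    using that[of y] y d_sym V d_edge[OF E_commute[OF y(1)]] E_neq[OF y(1)] by (auto simp: leg_def)
qed

text \<open>From the leg, \<open>w\<close> is seen only through \<open>v\<close>, so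
  \<open>v\<close> is the endpoint that attains the gap. The right-hand side does not mention
  \<open>u\<close>, hence two legs at \<open>v\<close> that \<open>w\<close> avoids look
  alike.\<close>

lemma ld_first_leg_edge:
  assumes "terminal v u" "(v, y) \<in> E" "y \<in> leg v u" "d u v = Suc (d u y)"
    and "w \<in> edges" "w \<inter> leg v u = {}"
  shows "ld {v, y} w = Suc (gap {v} w)"
proof -
  have ne: "{v, y} \<noteq> w" using assms by auto
  obtain z where "z \<in> w" using assms edges_ne by blast
  have V: "u \<in> V" "y \<in> V" using assms(1,2) terminal_V E_in_V by auto
  have le: "d v z \<le> d y z" if "z \<in> w" for z
  proof -
    have z: "z \<in> V" "z \<notin> leg v u" using that assms edges_V by auto
    then have "d u z = d u v + d v z" using not_leg assms by simp
    then show ?thesis using d_triangle[OF V z(1)] assms by simp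
  qed
  obtain x z1 where z1: "x \<in> {v, y}" "z1 \<in> w" "gap {v, y} w = d x z1"
    using gap_attained[OF edgesI[OF assms(2)] assms(5)] .
  have "\<exists>z\<in>w. d v z = gap {v} w"
    using LeastI_ex[of "\<lambda>n. \<exists>x\<in>{v}. \<exists>y\<in>w. d x y = n"] \<open>z \<in> w\<close> unfolding gap_def by blast
  then obtain z2 where z2: "z2 \<in> w" "d v z2 = gap {v} w" by auto
  have "gap {v} w \<le> d v z1" using gap_le z1 by simp
  also have "\<dots> \<le> gap {v, y} w" using z1 le by auto
  finally have "gap {v} w \<le> gap {v, y} w" .
  moreover have "gap {v, y} w \<le> gap {v} w" using gap_le[of v "{v, y}" z2 w] z2 by simp
  ultimately have "gap {v, y} w = gap {v} w" by simp
  then show ?thesis using ne by (simp add: ld_def)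
qed

lemma unmet_leg_unique:
  assumes "resolves W" "terminal v u" "terminal v u'"
    and "\<And>w. w \<in> W \<Longrightarrow> w \<inter> leg v u = {}" "\<And>w. w \<in> W \<Longrightarrow> w \<inter> leg v u' = {}"
  shows "u = u'"
proof (rule ccontr)
  assume ne: "u \<noteq> u'"
  obtain y where y: "(v, y) \<in> E" "y \<in> leg v u" "d u v = Suc (d u y)"
    using first_leg_edge assms by metis
  obtain y' where y': "(v, y') \<in> E" "y' \<in> leg v u'" "d u' v = Suc (d u' y')"
    using first_leg_edge assms by metis
  have "W \<subseteq> edges" using assms by (simp add: resolves_def)
  then have "ld {v, y} w = ld {v, y'} w" if "w \<in> W" for w
    using that ld_first_leg_edge[OF assms(2) y] ld_first_leg_edge[OF assms(3) y'] assms(4,5) by auto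
  then have "{v, y} = {v, y'}" using assms(1) y y' edgesI by (simp add: resolves_def)
  then have "y = y'" using E_neq y y' by (auto simp: doubleton_eq_iff)
  then show False using legs_apart[OF assms(2,3) ne y(2) y'(2)] by simp
qed

definition Ter :: "'a \<Rightarrow> 'a set" where "Ter v = {u. terminal v u}"

definition Ext :: "'a set" where "Ext = {v. major v \<and> (\<exists>u. terminal v u)}"

lemma finite_Ter: "finite (Ter v)"
  by (rule finite_subset[OF _ finite_V]) (auto simp: Ter_def terminal_V)

lemma finite_Ext: "finite Ext"
  by (rule finite_subset[OF _ finite_V]) (auto simp: Ext_def major_V)

lemma resolves_lower_bound:
  assumes "resolves W"
  shows "(\<Sum>v\<in>Ext. card (Ter v)) \<le> card W + card Ext"
proof -
  \<comment> \<open>The terminal vertices whose legs meet \<open>W\<close>; by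
    \<open>unmet_leg_unique\<close> they are all but at most one of \<open>Ter v\<close>.\<close>
  define met where "met v = {u \<in> Ter v. \<exists>w\<in>W. w \<inter> leg v u \<noteq> {}}" for v
  have W: "W \<subseteq> edges" "finite W" using assms finite_edges finite_subset by (auto simp: resolves_def)
  have fin: "finite (met v)" for v using finite_Ter by (simp add: met_def)
  have "card (Ter v) \<le> Suc (card (met v))" for v
  proof (cases "Ter v \<subseteq> met v")
    case True then show ?thesis using card_mono[OF fin] le_SucI by blast
  next
    case False
    then obtain u where u: "u \<in> Ter v" "u \<notin> met v" by auto
    have "Ter v \<subseteq> insert u (met v)"
    proof
      fix u' assume "u' \<in> Ter v"
      then show "u' \<in> insert u (met v)"
        using unmet_leg_unique[OF assms, of v u u'] u by (auto simp: met_def Ter_def)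
    qed
    then have "card (Ter v) \<le> card (insert u (met v))" using fin by (simp add: card_mono)
    then show ?thesis using fin u by simp
  qed
  then have "(\<Sum>v\<in>Ext. card (Ter v)) \<le> (\<Sum>v\<in>Ext. Suc (card (met v)))" by (rule sum_mono)
  also have "\<dots> = card (SIGMA v:Ext. met v) + card Ext"
    using finite_Ext fin by (simp add: sum_Suc)
  finally have *: "(\<Sum>v\<in>Ext. card (Ter v)) \<le> card (SIGMA v:Ext. met v) + card Ext" .
  have "\<forall>p\<in>(SIGMA v:Ext. met v). \<exists>w\<in>W. w \<inter> leg (fst p) (snd p) \<noteq> {}" by (auto simp: met_def)
  then obtain g where g: "\<And>p. p \<in> (SIGMA v:Ext. met v) \<Longrightarrow> g p \<in> W \<and> g p \<inter> leg (fst p) (snd p) \<noteq> {}"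
    by metis
  \<comment> \<open>\<open>g\<close> picks for each met leg an edge of \<open>W\<close> meeting it.
    Endpoints of one edge are at distance at most 1, too close for two legs.\<close>
  have "inj_on g (SIGMA v:Ext. met v)"
  proof (rule inj_onI)
    fix p q assume pq: "p \<in> (SIGMA v:Ext. met v)" "q \<in> (SIGMA v:Ext. met v)" "g p = g q"
    obtain v u v' u' where eq: "p = (v, u)" "q = (v', u')" by (cases p, cases q)
    have t: "terminal v u" "terminal v' u'" using pq eq by (auto simp: met_def Ter_def)
    obtain x y where xy: "x \<in> g p" "x \<in> leg v u" "y \<in> g p" "y \<in> leg v' u'"
      using g[OF pq(1)] g[OF pq(2)] pq(3) eq by auto
    have "d x y \<le> 1" using edges_diam xy g[OF pq(1)] W by blast
    then have "u = u'" using legs_apart[OF t _ xy(2,4)] by auto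
    then show "p = q" using terminal_unique t eq by auto
  qed
  then have "card (SIGMA v:Ext. met v) \<le> card W"
    using g W by (intro card_inj_on_le[of g]) auto
  then show ?thesis using * by simp
qed

section \<open>Branches and their position relative to major vertices\<close>

text \<open>All other major vertices lie outside the branch, so the way to them from
  \<open>l\<close> leads through \<open>v\<close>.\<close>

lemma branch_terminal:
  assumes "(v, y) \<in> E" "major v" "\<And>x. x \<in> branch v y \<Longrightarrow> \<not> major x"
    and "l \<in> branch v y" "deg l = 1"
  shows "terminal v l"
proof -
  have "d l v < d l w" if "major w" "w \<noteq> v" for w
  proof -
    have "w \<notin> branch v y" "w \<in> V" using that assms(3) major_V by auto
    then have "d l w = d l v + d v w" using branch_separates assms by simp
    moreover have "d v w \<noteq> 0" using that major_V assms(2) d_eq_0 by blast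
    ultimately show ?thesis by simp
  qed
  then show ?thesis using assms by (auto simp: terminal_def endv_def branch_def)
qed

lemma branches_disjoint:
  assumes "(x, y) \<in> E" "(x, z) \<in> E" "l \<in> branch x y" "l \<in> branch x z"
  shows "y = z"
proof -
  have V: "x \<in> V" "y \<in> V" "z \<in> V" "l \<in> V"
    using assms(1,2,3) E_in_V by (auto simp: branch_def)
  then show ?thesis
    using closer_neighbour_unique[OF assms(1,2) V(4)] assms(3,4) d_sym by (simp add: branch_def)
qed

text \<open>A branch at \<open>x\<close> pointing away from \<open>p\<close> reaches
  \<open>p\<close> only through \<open>x\<close>. Hence, if \<open>x\<close> is a major vertex of
  \<open>branch p a\<close> farthest from \<open>p\<close>, such a branch contains no major
  vertex.\<close>

lemma subbranch:
  assumes "(p, a) \<in> E" "x \<in> branch p a" "(x, y) \<in> E" "p \<notin> branch x y" "z \<in> branch x y"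
  shows "z \<in> branch p a" "d x p < d z p"
proof -
  have V: "p \<in> V" "a \<in> V" "x \<in> V" "z \<in> V" using assms E_in_V by (auto simp: branch_def)
  have zp: "d z p = d z x + d x p" using branch_separates assms V by simp
  have zx: "d z x > 0" using assms by (simp add: branch_def)
  show "d x p < d z p" using zp zx by simp
  have xp: "d x p = Suc (d x a)" using assms by (simp add: branch_def)
  have "d z a \<le> d z x + d x a" using d_triangle V by simp
  then have "\<not> d z a = Suc (d z p)" using zp xp by simp
  then show "z \<in> branch p a" using not_branch(1)[OF assms(1) V(4)] by auto
qed

lemma major_neighbour:
  assumes "major x" obtains y where "(x, y) \<in> E" "y \<noteq> p" "y \<noteq> q"
proof -
  have "\<not> E `` {x} \<subseteq> {p, q}"
  proof
    assume "E `` {x} \<subseteq> {p, q}"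
    then have "deg x \<le> card {p, q}" unfolding deg_def by (intro card_mono) auto
    also have "card {p, q} \<le> 2" by (simp add: card_insert_if)
    finally show False using assms by (simp add: major_def)
  qed
  then show thesis using that by auto
qed

text \<open>\<open>p\<close> is the neighbour of \<open>x\<close> towards \<open>r\<close>. If no
  branch contains \<open>r\<close>, as for \<open>r = x\<close>, the condition is vacuous and
  \<open>p\<close> is arbitrary; this form saves a case distinction.\<close>

lemma branch_towards:
  obtains p where "\<And>y. (x, y) \<in> E \<Longrightarrow> r \<in> branch x y \<Longrightarrow> y = p"
  using branches_disjoint by metis

section \<open>Pendant edges and the relative position of two edges\<close>

text \<open>For an end-vertex \<open>s\<close> the choice denotes its only neighbour.\<close>

definition pendant :: "'a \<Rightarrow> 'a set" where
  "pendant s = {s, SOME t. (s, t) \<in> E}"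

lemma pendant_neighbour:
  assumes "endv s" shows "(s, SOME t. (s, t) \<in> E) \<in> E"
proof (rule someI_ex)
  have "E `` {s} \<noteq> {}" using assms by (auto simp: endv_def deg_def)
  then show "\<exists>t. (s, t) \<in> E" by auto
qed

lemma pendant_edge: "endv s \<Longrightarrow> pendant s \<in> edges"
  unfolding pendant_def by (rule edgesI[OF pendant_neighbour])

text \<open>For an edge other than the pendant one, every path to \<open>s\<close> ends with the
  pendant edge: the gap stops one step short of \<open>s\<close>, and the \<open>Suc\<close> in
  \<open>ld\<close> restores that step.\<close>

lemma ld_pendant:
  assumes "endv s" "(a, b) \<in> E"
  shows "ld {a, b} (pendant s) = min (d a s) (d b s)"
proof -
  obtain t where t: "(s, t) \<in> E" "pendant s = {s, t}"
    using pendant_neighbour[OF assms(1)] by (auto simp: pendant_def)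
  have V: "a \<in> V" "b \<in> V" "s \<in> V" "t \<in> V" using assms t E_in_V by auto
  have closer: "d x s = Suc (d x t)" if x: "x \<in> V" "x \<noteq> s" for x
  proof -
    obtain t' where "(s, t') \<in> E" "d s x = Suc (d t' x)" using d_step[OF V(3) x(1)] x(2) by auto
    then show ?thesis using endv_neighbour_unique[OF assms(1) t(1)] d_sym V x by metis
  qed
  show ?thesis
  proof (cases "{a, b} = pendant s")
    case True
    then have "a = s \<or> b = s" using t(2) by auto
    then show ?thesis using True by (auto simp: ld_def)
  next
    case False
    have "x \<noteq> s" if "x \<in> {a, b}" for x
      using that False endv_neighbour_unique[OF assms(1) t(1)] assms(2) E_commute t(2) by auto
    then have cl: "d a s = Suc (d a t)" "d b s = Suc (d b t)" using closer V by auto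
    obtain x y where xy: "x \<in> {a, b}" "y \<in> pendant s" "gap {a, b} (pendant s) = d x y"
      using gap_attained[OF edgesI[OF assms(2)] pendant_edge[OF assms(1)]] .
    have "gap {a, b} (pendant s) \<le> d a t" "gap {a, b} (pendant s) \<le> d b t"
      using gap_le t(2) by auto
    moreover have "d x y = d a s \<or> d x y = d b s \<or> d x y = d a t \<or> d x y = d b t"
      using xy t(2) by auto
    ultimately have "gap {a, b} (pendant s) = min (d a t) (d b t)" using xy(3) cl by auto
    then show ?thesis using False cl by (simp add: ld_def)
  qed
qed

text \<open>\<open>b\<close> and \<open>c\<close> are endpoints that attain the gap, possibly equal.
  If \<open>g\<close> lay beyond \<open>a\<close>, the way from \<open>g\<close> to \<open>c\<close>
  would pass through \<open>b\<close>, forcing \<open>b = c\<close> and \<open>g = a\<close>, that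
  is \<open>e = f\<close>; likewise for \<open>a\<close> beyond \<open>g\<close>.\<close>

lemma edge_pair_position:
  assumes "e \<in> edges" "f \<in> edges" "e \<noteq> f"
  obtains a b c g where "e = {a, b}" "f = {c, g}" "(b, a) \<in> E" "(c, g) \<in> E"
    "c \<notin> branch b a" "g \<notin> branch b a" "a \<notin> branch c g" "b \<notin> branch c g"
proof -
  obtain b c where bc: "b \<in> e" "c \<in> f" "gap e f = d b c" using gap_attained assms by metis
  obtain a where a: "e = {b, a}" "(b, a) \<in> E" using edgesE[OF assms(1) bc(1)] .
  obtain g where g: "f = {c, g}" "(c, g) \<in> E" using edgesE[OF assms(2) bc(2)] .
  have V: "a \<in> V" "b \<in> V" "c \<in> V" "g \<in> V" using a g E_in_V by auto
  have le: "d b c \<le> d a c" "d b c \<le> d b g"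
    using gap_le[of a e c f] gap_le[of b e g f] a g bc by auto
  have c: "c \<notin> branch b a" using le(1) d_sym V by (auto simp: branch_def)
  have b: "b \<notin> branch c g" using le(2) d_sym V by (auto simp: branch_def)
  have same: "e = f" if "b = c" "a = g" using that a g by simp
  have gn: "g \<notin> branch b a"
  proof
    assume gb: "g \<in> branch b a"
    then have "d g c = d g b + d b c" using branch_separates[OF a(2) _ V(3) c] by simp
    moreover have "d g c = 1" using d_edge E_commute g by simp
    moreover have "d g b = Suc (d g a)" using gb by (simp add: branch_def)
    ultimately have "d b c = 0" "d g a = 0" by auto
    then show False using d_eq_0 V same assms(3) by auto
  qed
  have an: "a \<notin> branch c g"
  proof
    assume ac: "a \<in> branch c g"
    then have "d a b = d a c + d c b" using branch_separates[OF g(2) _ V(2) b] by simp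
    moreover have "d a b = 1" using d_edge E_commute a by simp
    moreover have "d a c = Suc (d a g)" using ac by (simp add: branch_def)
    ultimately have "d c b = 0" "d a g = 0" by auto
    then show False using d_eq_0 V same assms(3) by auto
  qed
  show thesis using that[of a b c g] a g c gn an b by auto
qed

section \<open>The upper bound\<close>

context
  fixes S :: "'a set"
  assumes S_endv: "\<And>s. s \<in> S \<Longrightarrow> endv s"
    and S_almost_all: "\<And>v u u'. terminal v u \<Longrightarrow> terminal v u' \<Longrightarrow> u \<noteq> u' \<Longrightarrow> u \<in> S \<or> u' \<in> S"
begin

text \<open>Take a major vertex \<open>m\<close> of the branch farthest from \<open>p\<close>. At
  least two branches at \<open>m\<close> point away from \<open>p\<close>; free of major vertices,
  they end in two terminal vertices of \<open>m\<close>, of which \<open>S\<close> omits at most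
  one.\<close>

lemma branch_with_major_meets:
  assumes "(p, a) \<in> E" "x \<in> branch p a" "major x"
  shows "branch p a \<inter> S \<noteq> {}"
proof -
  have "finite {x \<in> branch p a. major x}" using finite_V by (simp add: branch_def)
  then obtain m where m: "m \<in> branch p a" "major m"
    and max: "\<And>z. z \<in> branch p a \<Longrightarrow> major z \<Longrightarrow> d z p \<le> d m p"
    using finite_has_maximal[of "(\<lambda>z. d z p) ` {x \<in> branch p a. major x}"] assms(2,3) by fastforce
  have V: "p \<in> V" "m \<in> V" using assms(1) m E_in_V major_V by auto
  obtain q where q: "\<And>y. (m, y) \<in> E \<Longrightarrow> p \<in> branch m y \<Longrightarrow> y = q"
    using branch_towards by blast
  have leaf: "\<exists>l. l \<in> branch m y \<and> l \<in> branch p a \<and> terminal m l" if y: "(m, y) \<in> E" "y \<noteq> q" for y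
  proof -
    have np: "p \<notin> branch m y" using q y by auto
    have "\<not> major z" if "z \<in> branch m y" for z
      using subbranch[OF assms(1) m(1) y(1) np that] max[of z] by auto
    moreover obtain l where l: "l \<in> branch m y" "deg l = 1" using branch_has_end[OF y(1)] .
    ultimately have "terminal m l" using branch_terminal[OF y(1) m(2)] by blast
    then show ?thesis using l subbranch(1)[OF assms(1) m(1) y(1) np l(1)] by blast
  qed
  obtain y where y: "(m, y) \<in> E" "y \<noteq> q" using major_neighbour[OF m(2)] .
  obtain z where z: "(m, z) \<in> E" "z \<noteq> q" "z \<noteq> y" using major_neighbour[OF m(2)] .
  obtain l l' where l: "l \<in> branch m y" "l \<in> branch p a" "terminal m l"
    and l': "l' \<in> branch m z" "l' \<in> branch p a" "terminal m l'"
    using leaf[OF y] leaf[OF z(1,2)] by auto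
  have "l \<noteq> l'" using branches_disjoint[OF y(1) z(1)] l l' z(3) by auto
  then show ?thesis using S_almost_all[OF l(3) l'(3)] l(2) l'(2) by auto
qed

text \<open>A branch without major vertices ends in a terminal vertex of \<open>v\<close>, which
  lies in \<open>S\<close> because \<open>l\<close> is already the omitted one.\<close>

lemma branch_at_major_meets:
  assumes "(v, y) \<in> E" "terminal v l" "l \<notin> S" "l \<notin> branch v y"
  shows "branch v y \<inter> S \<noteq> {}"
proof (cases "\<exists>x. x \<in> branch v y \<and> major x")
  case True then show ?thesis using branch_with_major_meets assms(1) by blast
next
  case False
  obtain l' where l': "l' \<in> branch v y" "deg l' = 1" using branch_has_end[OF assms(1)] .
  then have "terminal v l'"
    using branch_terminal[OF assms(1)] False assms(2) by (auto simp: terminal_def)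
  then show ?thesis using S_almost_all[OF assms(2)] assms l' by blast
qed

text \<open>Of the at least three branches at \<open>v\<close>, one contains neither
  \<open>l\<close> nor \<open>w\<close>. It also contains neither \<open>b\<close>, which lies
  between \<open>l\<close> and \<open>v\<close>, nor \<open>c\<close>, which reaches
  \<open>v\<close> through \<open>w\<close>; so any \<open>s\<close> of \<open>S\<close> in it sees
  both through \<open>v\<close>.\<close>

lemma separating_leaf:
  assumes "terminal v l" "l \<notin> S" "w \<in> V" "v \<noteq> w" "b \<in> V" "c \<in> V"
    and "d l v = d l b + d b v" "d c v = d c w + d w v"
  obtains s where "s \<in> S" "d s b = d s v + d v b" "d s c = d s v + d v c"
proof -
  have V: "v \<in> V" "l \<in> V" using terminal_V assms(1) by auto
  obtain p where p: "\<And>y. (v, y) \<in> E \<Longrightarrow> l \<in> branch v y \<Longrightarrow> y = p"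
    using branch_towards by blast
  obtain q where q: "\<And>y. (v, y) \<in> E \<Longrightarrow> w \<in> branch v y \<Longrightarrow> y = q"
    using branch_towards by blast
  have "major v" using assms by (simp add: terminal_def)
  then obtain y where y: "(v, y) \<in> E" "y \<noteq> p" "y \<noteq> q" using major_neighbour by metis
  have yV: "y \<in> V" using y E_in_V by simp
  have l: "l \<notin> branch v y" and w: "w \<notin> branch v y" using p q y by auto
  obtain s where s: "s \<in> S" "s \<in> branch v y"
    using branch_at_major_meets[OF y(1) assms(1,2) l] by auto
  have b: "b \<notin> branch v y"
  proof
    assume "b \<in> branch v y"
    then have "d b v = Suc (d b y)" by (simp add: branch_def)
    moreover have "d l y = Suc (d l v)" using not_branch(1)[OF y(1) V(2) l] .
    moreover have "d l y \<le> d l b + d b y" using d_triangle V assms yV by simp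
    ultimately show False using assms(7) by simp
  qed
  have c: "c \<notin> branch v y"
  proof
    assume "c \<in> branch v y"
    then have "d c w = d c v + d v w" using branch_separates[OF y(1) _ assms(3) w] by simp
    then have "d v w = 0" using assms(8) by simp
    then show False using d_eq_0 V assms by simp
  qed
  show thesis
    using that[OF s(1)] branch_separates[OF y(1) s(2) assms(5) b]
      branch_separates[OF y(1) s(2) assms(6) c] by simp
qed

text \<open>From \<open>s\<close> the edge \<open>{a, b}\<close> begins at \<open>a\<close>, whereas
  \<open>c\<close> and \<open>g\<close> are reached only through \<open>b\<close>. So a vertex of
  \<open>S\<close> beyond \<open>a\<close> separates the two edges.\<close>

lemma ld_pendant_branch:
  assumes "(b, a) \<in> E" "s \<in> branch b a" "s \<in> S"
    and "(c, g) \<in> E" "c \<notin> branch b a" "g \<notin> branch b a"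
  shows "ld {a, b} (pendant s) < ld {c, g} (pendant s)"
proof -
  have V: "c \<in> V" "g \<in> V" "a \<in> V" "b \<in> V" "s \<in> V"
    using assms E_in_V by (auto simp: branch_def)
  have "d s c = d s b + d b c" "d s g = d s b + d b g"
    using branch_separates[OF assms(1,2)] V assms(5,6) by blast+
  moreover have "d s b = Suc (d s a)" using assms(2) by (simp add: branch_def)
  moreover have "d c s = d s c" "d g s = d s g" "d b s = d s b" "d a s = d s a" using d_sym V by auto
  ultimately show ?thesis
    using ld_pendant[OF S_endv[OF assms(3)]] assms(4) E_commute[OF assms(1)] by simp
qed

text \<open>A branch that misses \<open>S\<close> contains no major vertex, so the major vertex
  nearest to its end lies outside.\<close>

lemma unmet_branch_terminal:
  assumes "(b, a) \<in> E" "branch b a \<inter> S = {}" "major m"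
  obtains l v where "l \<in> branch b a" "l \<notin> S" "terminal v l" "v \<notin> branch b a"
proof -
  obtain l where l: "l \<in> branch b a" "deg l = 1" using branch_has_end[OF assms(1)] .
  then have "endv l" by (simp add: endv_def branch_def)
  then obtain v where v: "terminal v l" using terminal_exists assms(3) by metis
  then have "major v" by (simp add: terminal_def)
  then have "v \<notin> branch b a" using branch_with_major_meets[OF assms(1)] assms(2) by auto
  then show thesis using that l v assms(2) by blast
qed

lemma resolves_pendants:
  assumes "major m"
  shows "resolves (pendant ` S)"
  unfolding resolves_def
proof (intro conjI ballI impI)
  show "pendant ` S \<subseteq> edges" using pendant_edge S_endv by auto
next
  fix e f assume ef: "e \<in> edges" "f \<in> edges"
    and eq: "\<forall>w\<in>pendant ` S. ld e w = ld f w"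
  show "e = f"
  proof (rule ccontr)
    assume "e \<noteq> f"
    then obtain a b c g where e: "e = {a, b}" "(b, a) \<in> E" and f: "f = {c, g}" "(c, g) \<in> E"
      and cg: "c \<notin> branch b a" "g \<notin> branch b a" and ab: "a \<notin> branch c g" "b \<notin> branch c g"
      using edge_pair_position[OF ef] by metis
    have V: "a \<in> V" "b \<in> V" "c \<in> V" "g \<in> V" using e f E_in_V by auto
    have un1: "branch b a \<inter> S = {}"
      using ld_pendant_branch[OF e(2) _ _ f(2) cg] eq e f by fastforce
    have un2: "branch c g \<inter> S = {}"
      using ld_pendant_branch[OF f(2) _ _ e(2) ab(2,1)] eq e f by (fastforce simp: insert_commute)
    \<comment> \<open>No vertex of \<open>S\<close> lies beyond \<open>a\<close> or beyond
      \<open>g\<close>, so \<open>b\<close> and \<open>c\<close> are the endpoints that determine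
      the distances to \<open>pendant s\<close>.\<close>
    have S_eq: "d s b = d s c" if s: "s \<in> S" for s
    proof -
      have sV: "s \<in> V" using S_endv[OF s] endv_V by simp
      have "d s a = Suc (d s b)" "d s g = Suc (d s c)"
        using not_branch(1)[OF e(2) sV] not_branch(1)[OF f(2) sV] un1 un2 s by auto
      moreover have "ld {a, b} (pendant s) = ld {c, g} (pendant s)" using eq e f s by auto
      ultimately show ?thesis
        using ld_pendant[OF S_endv[OF s]] e f(2) E_commute[OF e(2)] d_sym V sV by simp
    qed
    obtain l v where l: "l \<in> branch b a" "l \<notin> S" "terminal v l" "v \<notin> branch b a"
      using unmet_branch_terminal[OF e(2) un1 assms] .
    obtain k w where k: "k \<in> branch c g" "k \<notin> S" "terminal w k" "w \<notin> branch c g"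
      using unmet_branch_terminal[OF f(2) un2 assms] .
    have vw: "v \<in> V" "w \<in> V" "l \<in> V" "k \<in> V" "major v" "major w"
      using terminal_V l k by (auto simp: terminal_def)
    \<comment> \<open>From beyond \<open>a\<close>, the edge \<open>f\<close> is entered at
      \<open>c\<close>; from beyond \<open>g\<close>, at \<open>g\<close>.\<close>
    have "l \<noteq> k"
    proof
      assume "l = k"
      then have "d l c = Suc (d l g)" using k by (simp add: branch_def)
      moreover have "d l c = d l b + d b c" "d l g = d l b + d b g"
        using branch_separates[OF e(2) l(1)] V cg by auto
      moreover have "d b g = Suc (d b c)" using not_branch(1)[OF f(2) V(2) ab(2)] .
      ultimately show False by simp
    qed
    then have ne: "v \<noteq> w" using S_almost_all[of v l k] l k by auto
    have lv: "d l v = d l b + d b v" using branch_separates[OF e(2) l(1) vw(1) l(4)] .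
    have kw: "d k w = d k c + d c w" using branch_separates[OF f(2) k(1) vw(2) k(4)] .
    have bw: "d b w = d b v + d v w"
    proof -
      have "d l w = d l v + d v w" using terminal_major[OF l(3) vw(6)] .
      moreover have "d l w \<le> d l b + d b w" "d b w \<le> d b v + d v w"
        using vw V by (simp_all add: d_triangle)
      ultimately show ?thesis using lv by simp
    qed
    have cv: "d c v = d c w + d w v"
    proof -
      have "d k v = d k w + d w v" using terminal_major[OF k(3) vw(5)] .
      moreover have "d k v \<le> d k c + d c v" "d c v \<le> d c w + d w v"
        using vw V by (simp_all add: d_triangle)
      ultimately show ?thesis using kw by simp
    qed
    obtain s where s: "s \<in> S" "d s b = d s v + d v b" "d s c = d s v + d v c"
      using separating_leaf[OF l(3,2) vw(2) ne V(2,3) lv cv] .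
    obtain t where t: "t \<in> S" "d t c = d t w + d w c" "d t b = d t w + d w b"
      using separating_leaf[OF k(3,2) vw(1) ne[symmetric] V(3,2) kw bw] .
    have "d v b = d v c" "d w c = d w b" using S_eq s t by auto
    \<comment> \<open>Substituting the two equalities into \<open>bw\<close> and \<open>cv\<close>
      makes \<open>d w b\<close> exceed \<open>d v b\<close> by \<open>d v w\<close> and
      conversely.\<close>
    then have "d v w = 0" using bw cv d_sym V vw by simp
    then show False using ne d_eq_0 vw by simp
  qed
qed

end

lemma resolves_exists:
  assumes "major m"
  obtains W where "resolves W" "card W + card Ext \<le> (\<Sum>v\<in>Ext. card (Ter v))"
proof -
  have "\<forall>v\<in>Ext. \<exists>u. u \<in> Ter v" by (auto simp: Ext_def Ter_def)
  \<comment> \<open>\<open>c v\<close> is the one terminal vertex of \<open>v\<close> that is left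
    out.\<close>
  then obtain c where c: "\<And>v. v \<in> Ext \<Longrightarrow> c v \<in> Ter v" by metis
  define S where "S = (\<Union>v\<in>Ext. Ter v - {c v})"
  have S_endv: "endv s" if "s \<in> S" for s
    using that by (auto simp: S_def Ter_def terminal_def)
  have S_all: "u \<in> S \<or> u' \<in> S" if "terminal v u" "terminal v u'" "u \<noteq> u'" for v u u'
  proof -
    have "v \<in> Ext" using that by (auto simp: Ext_def terminal_def)
    then show ?thesis using that by (auto simp: S_def Ter_def)
  qed
  have fin: "finite S" using finite_Ext finite_Ter by (simp add: S_def)
  have "card (pendant ` S) \<le> card S" using fin by (rule card_image_le)
  also have "card S \<le> (\<Sum>v\<in>Ext. card (Ter v - {c v}))"
    unfolding S_def by (rule card_UN_le[OF finite_Ext])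
  finally have "card (pendant ` S) + card Ext \<le> (\<Sum>v\<in>Ext. card (Ter v - {c v})) + card Ext" by simp
  also have "\<dots> = (\<Sum>v\<in>Ext. Suc (card (Ter v - {c v})))" by (simp add: sum_Suc)
  also have "\<dots> = (\<Sum>v\<in>Ext. card (Ter v))"
    using c finite_Ter by (intro sum.cong) (simp_all only: card_Suc_Diff1)
  finally have "card (pendant ` S) + card Ext \<le> (\<Sum>v\<in>Ext. card (Ter v))" .
  moreover have "resolves (pendant ` S)"
    using S_all by (intro resolves_pendants[OF S_endv _ assms]) blast+
  ultimately show thesis using that by blast
qed

end

section \<open>Trees without major vertices are paths\<close>

lemma set_vwalk_arcs: "set (vwalk_arcs p) = {(p ! i, p ! Suc i) | i. Suc i < length p}"
proof (induction p rule: vwalk_arcs.induct)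
  case (3 x y xs)
  have "{(p ! i, p ! Suc i) | i. Suc i < length p} =
      insert (x, y) {((y # xs) ! i, (y # xs) ! Suc i) | i. Suc i < length (y # xs)}" (is "?l = ?r")
    if p: "p = x # y # xs" for p
  proof
    show "?l \<subseteq> ?r"
    proof
      fix z assume "z \<in> ?l"
      then obtain i where "z = (p ! i, p ! Suc i)" "Suc i < length p" by auto
      then show "z \<in> ?r" using p by (cases i) auto
    qed
    show "?r \<subseteq> ?l"
    proof
      fix z assume "z \<in> ?r"
      then consider "z = (x, y)"
        | i where "z = ((y # xs) ! i, (y # xs) ! Suc i)" "Suc i < length (y # xs)" by auto
      then show "z \<in> ?l"
      proof cases
        case 1 then show ?thesis using p by (auto intro!: exI[of _ 0])
      next
        case 2 then show ?thesis using p by (auto intro!: exI[of _ "Suc i"])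
      qed
    qed
  qed
  then show ?case using "3.IH" by simp
qed auto

context tree_relation
begin

text \<open>Unless there is just one vertex, listing the vertices by their distance from an
  end-vertex \<open>u\<close> gives the path.\<close>

lemma no_major_imp_path:
  assumes "\<And>m. \<not> major m"
  shows "\<exists>p. p \<noteq> [] \<and> distinct p \<and> set p = V \<and>
    E = set (vwalk_arcs p) \<union> (set (vwalk_arcs p))\<inverse>"
proof (cases "E = {}")
  case True
  obtain r where r: "r \<in> V" using V_nonempty by auto
  have "x = r" if "x \<in> V" for x using E_connected[OF that r] True by simp
  then have "V = {r}" using r by blast
  then show ?thesis using True by (intro exI[of _ "[r]"]) simp
next
  case False
  then obtain x y where "(x, y) \<in> E" by auto
  then obtain u where "u \<in> branch x y" "deg u = 1" using branch_has_end by metis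
  then have u: "endv u" "u \<in> V" by (auto simp: endv_def branch_def)
  \<comment> \<open>With no major vertex to part at, one of two geodesics from \<open>u\<close>
    extends the other; if they are equally long, they end at the same vertex.\<close>
  have inj: "inj_on (d u) V"
  proof (rule inj_onI)
    fix x y assume xy: "x \<in> V" "y \<in> V" "d u x = d u y"
    then have "d x y = 0 \<or> d y x = 0"
      using geodesics_from_end[OF u(1) xy(2,1)] assms by auto
    then show "x = y" using d_eq_0 xy by auto
  qed
  have down: "i \<in> d u ` V" if i: "Suc i \<in> d u ` V" for i
  proof -
    obtain x where x: "x \<in> V" "d u x = Suc i" using i by auto
    then have "x \<noteq> u" by auto
    then obtain x' where "(x, x') \<in> E" "d x u = Suc (d x' u)" using d_step x u by metis
    then have "x' \<in> V" "d u x' = i" using x u d_sym E_in_V by auto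
    then show ?thesis by auto
  qed
  define n where "n = Max (d u ` V)"
  have fin: "finite (d u ` V)" and ne: "d u ` V \<noteq> {}" using finite_V V_nonempty by auto
  \<comment> \<open>The distances attained are closed downwards, so all values up to the maximum
    \<open>n\<close> occur; the induction descends from \<open>n\<close>.\<close>
  have "i \<le> n \<Longrightarrow> i \<in> d u ` V" for i
  proof (induction "n - i" arbitrary: i)
    case 0 then show ?case using Max_in[OF fin ne] by (simp add: n_def)
  next
    case (Suc k)
    then show ?case using down[of i] by simp
  qed
  moreover have "i \<le> n" if "i \<in> d u ` V" for i using Max_ge[OF fin that] by (simp add: n_def)
  ultimately have im: "d u ` V = {..n}" by auto
  define g where "g = the_inv_into V (d u)"
  define p where "p = map g [0..<Suc n]"
  have dg: "d u (g i) = i" "g i \<in> V" if "i \<le> n" for i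
    using f_the_inv_into_f[OF inj, of i] the_inv_into_into[OF inj, of i V] that im
    by (auto simp: g_def)
  have gd: "g (d u x) = x" "d u x \<le> n" if "x \<in> V" for x
    using the_inv_into_f_f[OF inj that] that im by (auto simp: g_def)
  have "distinct p"
    unfolding p_def distinct_map using inj_on_inverseI[of "{..n}" "d u" g] dg(1)
    by (auto simp: atLeast0LessThan lessThan_Suc_atMost simp del: upt_Suc)
  moreover have "set p = V"
  proof
    show "set p \<subseteq> V" using dg(2) by (auto simp: p_def simp del: upt_Suc)
    show "V \<subseteq> set p"
    proof
      fix x assume "x \<in> V"
      then have "d u x \<in> {0..<Suc n}" "g (d u x) = x" using gd[of x] by auto
      then show "x \<in> set p" unfolding p_def set_map set_upt by (metis imageI)
    qed
  qed
  moreover have "E = set (vwalk_arcs p) \<union> (set (vwalk_arcs p))\<inverse>"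
  proof -
    have arcs: "set (vwalk_arcs p) = {(g i, g (Suc i)) | i. Suc i \<le> n}"
    proof -
      have len: "length p = Suc n" by (simp add: p_def)
      have nth: "p ! i = g i" if "i \<le> n" for i
        using that nth_map_upt[of i "Suc n" 0 g] by (simp add: p_def less_Suc_eq_le del: upt_Suc)
      have "(z = (p ! i, p ! Suc i) \<and> Suc i < length p) = (z = (g i, g (Suc i)) \<and> Suc i \<le> n)" for z i
        using nth[of i] nth[of "Suc i"] by (cases "Suc i \<le> n") (simp_all add: len)
      then show ?thesis unfolding set_vwalk_arcs by simp
    qed
    have next_edge: "(g i, g (Suc i)) \<in> E" if i: "Suc i \<le> n" for i
    proof -
      have V: "g i \<in> V" "g (Suc i) \<in> V" "d u (g i) = i" "d u (g (Suc i)) = Suc i"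
        using dg i by auto
      then have "g (Suc i) \<noteq> u" by auto
      then obtain x where x: "(g (Suc i), x) \<in> E" "d (g (Suc i)) u = Suc (d x u)"
        using d_step V u by metis
      then have "x \<in> V" "d u x = d u (g i)" using V u d_sym E_in_V by auto
      then have "x = g i" using inj V by (simp add: inj_on_def)
      then show ?thesis using x E_commute by simp
    qed
    have up: "(x, y) \<in> set (vwalk_arcs p)" if "x \<in> V" "y \<in> V" "d u y = Suc (d u x)" for x y
    proof -
      have "(x, y) = (g (d u x), g (Suc (d u x)))" "Suc (d u x) \<le> n"
        using gd[OF that(1)] gd[OF that(2)] that(3) by simp_all
      then show ?thesis unfolding arcs by blast
    qed
    have "(x, y) \<in> set (vwalk_arcs p) \<union> (set (vwalk_arcs p))\<inverse>" if xy: "(x, y) \<in> E" for x y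
    proof -
      have V: "x \<in> V" "y \<in> V" using xy E_in_V by auto
      have "d u y = Suc (d u x) \<or> d u x = Suc (d u y)"
        using edge_d_cases[OF xy u(2)] unfolding d_sym[OF V(1) u(2)] d_sym[OF V(2) u(2)] by blast
      then show ?thesis using up[OF V] up[OF V(2,1)] by blast
    qed
    then have "E \<subseteq> set (vwalk_arcs p) \<union> (set (vwalk_arcs p))\<inverse>" by (rule subrelI)
    moreover have "set (vwalk_arcs p) \<subseteq> E" using next_edge by (auto simp: arcs)
    ultimately show ?thesis using E_commute by blast
  qed
  moreover have "p \<noteq> []" by (simp add: p_def)
  ultimately show ?thesis by blast
qed

end

section \<open>Transfer to the digraphs of the library\<close>

text \<open>By \<open>lip\<close>, no walk from \<open>x\<close> to \<open>r\<close> is shorter than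
  \<open>f x\<close>; following the descents of \<open>step\<close> produces a walk of exactly that
  length. It serves both the tree and its line graph.\<close>

lemma graph_dist_eqI:
  fixes f :: "'a \<Rightarrow> nat"
  assumes "wf_digraph G" "x \<in> verts G" "r \<in> verts G" "f r = 0"
    and lip: "\<And>x y. (x, y) \<in> arcs_ends G \<Longrightarrow> f x \<le> Suc (f y)"
    and step: "\<And>x. x \<in> verts G \<Longrightarrow> x \<noteq> r \<Longrightarrow> \<exists>y. (x, y) \<in> arcs_ends G \<and> f x = Suc (f y)"
  shows "graph_dist G x r = ereal (real (f x))"
proof -
  interpret wf_digraph G by fact
  have cost: "awalk_cost (\<lambda>_. 1) p = real (length p)" for p by (induction p) auto
  have lower: "f x \<le> length p" if "awalk x p r" for x p
    using that
  proof (induction p arbitrary: x)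
    case Nil then show ?case using \<open>f r = 0\<close> by (simp add: awalk_Nil_iff)
  next
    case (Cons e p)
    then have e: "e \<in> arcs G" "tail G e = x" "awalk (head G e) p r" by (auto simp: awalk_Cons_iff)
    then have "(x, head G e) \<in> arcs_ends G" by (auto simp: arcs_ends_conv)
    then show ?case using lip[of x "head G e"] Cons.IH[OF e(3)] by simp
  qed
  have "\<exists>p. awalk x p r \<and> length p = f x" if "x \<in> verts G" for x
    using that
  proof (induction "f x" arbitrary: x)
    case 0
    then have "x = r" using step[of x] by auto
    then show ?case using 0 by (intro exI[of _ "[]"]) (simp add: awalk_Nil_iff)
  next
    case (Suc n)
    then have "x \<noteq> r" using \<open>f r = 0\<close> by auto
    then obtain y where y: "(x, y) \<in> arcs_ends G" "f x = Suc (f y)" using step Suc.prems by blast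
    then obtain e where e: "e \<in> arcs G" "tail G e = x" "head G e = y" by (auto simp: arcs_ends_conv)
    then have "y \<in> verts G" by auto
    then obtain p where "awalk y p r" "length p = f y" using Suc.hyps(1)[of y] Suc.hyps(2) y by auto
    then show ?case using e y Suc.prems by (intro exI[of _ "e # p"]) (simp add: awalk_Cons_iff)
  qed
  then obtain p where p: "awalk x p r" "length p = f x" using assms(2) by blast
  show ?thesis
    unfolding graph_dist_def \<mu>_def
  proof (rule antisym)
    show "(INF p\<in>{p. awalk x p r}. ereal (awalk_cost (\<lambda>_. 1) p)) \<le> ereal (real (f x))"
      using p by (auto intro!: INF_lower2[of p] simp: cost)
    show "ereal (real (f x)) \<le> (INF p\<in>{p. awalk x p r}. ereal (awalk_cost (\<lambda>_. 1) p))"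
      using lower by (auto intro!: INF_greatest simp: cost)
  qed
qed

text \<open>For the acyclicity condition, a path from \<open>x\<close> to \<open>y\<close> that
  avoids \<open>a\<close> is closed by the arcs from \<open>a\<close> to \<open>x\<close> and from
  \<open>y\<close> to \<open>a\<close>. If \<open>x\<close> and \<open>y\<close> differ, this is a
  cycle with at least three arcs.\<close>

lemma tree_relation_undirected_tree:
  assumes "undirected_tree G"
  shows "tree_relation (verts G) (arcs_ends G)"
proof -
  interpret graph G using assms by (simp add: undirected_tree_def)
  have conn: "strongly_connected G"
    using assms symmetric_connected_imp_strongly_connected sym_arcs by (simp add: undirected_tree_def)
  have acyc: "length p < 3" if "cycle p" for p
    using that assms by (auto simp: undirected_tree_def)
  show ?thesis
  proof
    show "finite (verts G)" by simp
    show "verts G \<noteq> {}" using conn by (simp add: strongly_connected_def)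
    show "arcs_ends G \<subseteq> verts G \<times> verts G" by (auto simp: arcs_ends_conv)
    show "sym (arcs_ends G)" using sym_arcs by (simp add: symmetric_def)
    show "irrefl (arcs_ends G)" using no_loops by (auto simp: irrefl_def arcs_ends_conv)
    show "(x, y) \<in> (arcs_ends G)\<^sup>*" if "x \<in> verts G" "y \<in> verts G" for x y
      using conn that by (auto simp: strongly_connected_def intro: reachable_rtranclI)
  next
    fix a x y
    assume ax: "(a, x) \<in> arcs_ends G" and ay: "(a, y) \<in> arcs_ends G"
      and xy: "(x, y) \<in> (arcs_ends G \<inter> (- {a}) \<times> (- {a}))\<^sup>*"
    obtain e1 where e1: "e1 \<in> arcs G" "tail G e1 = a" "head G e1 = x"
      using ax by (auto simp: arcs_ends_conv)
    have "(y, a) \<in> arcs_ends G" using ay sym_arcs unfolding symmetric_def by (rule symD[rotated])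
    then obtain e2 where e2: "e2 \<in> arcs G" "tail G e2 = y" "head G e2 = a"
      by (auto simp: arcs_ends_conv)
    have xa: "x \<noteq> a" using e1 no_loops[OF e1(1)] by auto
    \<comment> \<open>Avoiding \<open>a\<close> is recorded through the heads of the arcs, which
      with \<open>x\<close> are all the vertices of the walk; so it passes to the arc subset kept by
      \<open>awalk_to_apath\<close>.\<close>
    have "\<exists>p. awalk x p y \<and> (\<forall>e\<in>set p. head G e \<noteq> a)"
      using xy
    proof (induction rule: rtrancl_induct)
      case base
      show ?case using e1 by (intro exI[of _ "[]"]) (auto simp: awalk_Nil_iff)
    next
      case (step y z)
      then obtain p where p: "awalk x p y" "\<forall>e\<in>set p. head G e \<noteq> a" by auto
      obtain e where e: "e \<in> arcs G" "tail G e = y" "head G e = z" "z \<noteq> a"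
        using step(2) by (auto simp: arcs_ends_conv)
      then have "awalk x (p @ [e]) z" using p by (auto simp: awalk_simps)
      then show ?case using p e by (intro exI[of _ "p @ [e]"]) simp
    qed
    then obtain q where q: "awalk x q y" "\<forall>e\<in>set q. head G e \<noteq> a" by auto
    define p where "p = awalk_to_apath q"
    have p: "apath x p y" "\<forall>e\<in>set p. head G e \<noteq> a"
      using apath_awalk_to_apath[OF q(1)] awalk_to_apath_subset[OF q(1)] q(2)
      by (auto simp: p_def)
    have wp: "awalk x p y" "distinct (awalk_verts x p)" using p(1) by (auto simp: apath_def)
    have nv: "a \<notin> set (awalk_verts x p)"
      using awalk_verts_conv'[of x p y] wp(1) p(2) xa by (auto simp: awalk_def cas_simp)
    show "x = y"
    proof (rule ccontr)
      assume "x \<noteq> y"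
      then have "p \<noteq> []" using wp(1) by (auto simp: awalk_Nil_iff)
      let ?c = "e1 # p @ [e2]"
      have w: "awalk a ?c a" using e1 e2 wp(1) by (auto simp: awalk_simps)
      have "awalk_verts a ?c = a # awalk_verts x p @ [a]"
        using awalk_verts_conv'[of a ?c a] awalk_verts_conv'[of x p y] w wp(1) e1 e2
      by (auto simp: awalk_def cas_simp)
      then have "cycle ?c" unfolding cycle_def using w nv wp(2) by (intro exI[of _ a]) simp
      then have "length ?c < 3" by (rule acyc)
      then show False using \<open>p \<noteq> []\<close> by (cases p) auto
    qed
  qed
qed

theorem proposition3p3:
  fixes T :: "('a, 'b) pre_digraph"
  assumes "undirected_tree T"
    and "\<not> path_graph T"
  shows "int (metric_dimension (line_graph T)) = int (sigma T) - int (ex_count T)"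
proof -
  interpret graph T using assms(1) by (simp add: undirected_tree_def)
  interpret tr: tree_relation "verts T" "arcs_ends T"
    using assms(1) by (rule tree_relation_undirected_tree)
  \<comment> \<open>The coercion \<open>with_proj\<close> is implicit in the statement of the
    theorem.\<close>
  let ?L = "with_proj (line_graph T)"
  have distT: "graph_dist T x y = ereal (real (tr.d x y))" if "x \<in> verts T" "y \<in> verts T" for x y
  proof (rule graph_dist_eqI[OF wf_digraph that])
    show "tr.d x y \<le> Suc (tr.d z y)" if "(x, z) \<in> arcs_ends T" for x z
      using tr.d_edge_le that \<open>y \<in> verts T\<close> .
    show "\<exists>z. (x, z) \<in> arcs_ends T \<and> tr.d x y = Suc (tr.d z y)" if "x \<in> verts T" "x \<noteq> y" for x
      using tr.d_step[OF that(1) \<open>y \<in> verts T\<close> that(2)] by metis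
  qed simp
  have deg: "out_degree T x = tr.deg x" for x
  proof -
    \<comment> \<open>Without parallel arcs, the arcs leaving \<open>x\<close> correspond to its
      neighbours.\<close>
    have "inj_on (head T) (out_arcs T x)"
      using no_multi_arcs by (auto simp: inj_on_def arc_to_ends_def)
    moreover have "head T ` out_arcs T x = arcs_ends T `` {x}"
      by (auto simp: arcs_ends_conv)
    ultimately show ?thesis unfolding out_degree_def tr.deg_def by (metis card_image)
  qed
  have major: "major_vertex T x \<longleftrightarrow> tr.major x" for x
    by (simp add: major_vertex_def tr.major_def deg)
  have endv: "end_vertex T x \<longleftrightarrow> tr.endv x" for x
    by (simp add: end_vertex_def tr.endv_def deg)
  have terminal: "terminal_vertex T v u \<longleftrightarrow> tr.terminal v u" for v u
    unfolding terminal_vertex_def tr.terminal_def major endv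
    using distT tr.major_V tr.endv_V by auto
  have Ter: "TER T v = tr.Ter v" and Ext: "EX_major T = tr.Ext" for v
    by (simp_all add: TER_def tr.Ter_def EX_major_def tr.Ext_def terminal major)
  have "(\<lambda>(x, y). {x, y}) ` arcs_ends T = (\<lambda>e. {tail T e, head T e}) ` arcs T"
    by (simp add: arcs_ends_conv image_image)
  then have edges: "tr.edges = (\<lambda>e. {tail T e, head T e}) ` arcs T"
    by (simp only: tr.edges_def)
  have verts_L: "verts ?L = tr.edges"
    by (simp add: line_graph_def Let_def edges)
  have arcs_L: "arcs_ends ?L = {(e, f). e \<in> tr.edges \<and> f \<in> tr.edges \<and> e \<noteq> f \<and> e \<inter> f \<noteq> {}}"
    unfolding arcs_ends_conv[of ?L] edges by (simp add: line_graph_def Let_def)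
  interpret L: graph ?L using graph_line_graph graph_axioms .
  have distL: "graph_dist ?L e w = ereal (real (tr.ld e w))" if "e \<in> tr.edges" "w \<in> tr.edges" for e w
  proof (rule graph_dist_eqI[OF L.wf_digraph])
    show "e \<in> verts ?L" "w \<in> verts ?L" using that verts_L by auto
    show "tr.ld w w = 0" by (simp add: tr.ld_def)
    show "tr.ld e w \<le> Suc (tr.ld f w)" if "(e, f) \<in> arcs_ends ?L" for e f
      using that \<open>w \<in> tr.edges\<close> tr.ld_lipschitz unfolding arcs_L by blast
    show "\<exists>f. (e, f) \<in> arcs_ends ?L \<and> tr.ld e w = Suc (tr.ld f w)" if e: "e \<in> verts ?L" "e \<noteq> w" for e
    proof -
      have "e \<in> tr.edges" using e(1) verts_L by simp
      then obtain f where "f \<in> tr.edges" "f \<noteq> e" "e \<inter> f \<noteq> {}" "tr.ld e w = Suc (tr.ld f w)"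
        using tr.ld_step \<open>w \<in> tr.edges\<close> e(2) by metis
      then show ?thesis using \<open>e \<in> tr.edges\<close> unfolding arcs_L by blast
    qed
  qed
  have res: "resolving_set ?L W \<longleftrightarrow> tr.resolves W" for W
  proof (cases "W \<subseteq> tr.edges")
    case True
    then have *: "(\<forall>w\<in>W. graph_dist ?L e w = graph_dist ?L f w) \<longleftrightarrow> (\<forall>w\<in>W. tr.ld e w = tr.ld f w)"
      if "e \<in> tr.edges" "f \<in> tr.edges" for e f
      using distL that by (metis ereal.inject of_nat_eq_iff subsetD)
    show ?thesis
      unfolding resolving_set_def tr.resolves_def verts_L
      using True finite_subset[OF True tr.finite_edges] by (simp add: * cong: ball_cong)
  next
    case False
    then show ?thesis unfolding resolving_set_def tr.resolves_def verts_L by blast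
  qed
  \<comment> \<open>This is where \<open>T\<close> not being a path enters.\<close>
  have "\<exists>m. tr.major m"
  proof (rule ccontr)
    assume "\<nexists>m. tr.major m"
    then obtain p where "p \<noteq> []" "distinct p" "set p = verts T"
      "arcs_ends T = set (vwalk_arcs p) \<union> (set (vwalk_arcs p))\<inverse>"
      using tr.no_major_imp_path by metis
    then have "path_graph T" unfolding path_graph_def vpath_def vwalk_def by blast
    then show False using assms(2) by simp
  qed
  then obtain W where W: "tr.resolves W" "card W + card tr.Ext \<le> (\<Sum>v\<in>tr.Ext. card (tr.Ter v))"
    using tr.resolves_exists by metis
  have "metric_dimension ?L = card W"
    unfolding metric_dimension_def res
  proof (rule Least_equality)
    show "\<exists>W'. tr.resolves W' \<and> card W' = card W" using W by blast
    show "card W \<le> k" if "\<exists>W'. tr.resolves W' \<and> card W' = k" for k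
      using that tr.resolves_lower_bound W(2) by fastforce
  qed
  moreover have "sigma T = card W + ex_count T"
    using W(2) tr.resolves_lower_bound[OF W(1)] by (simp add: sigma_def ex_count_def Ter Ext)
  ultimately show ?thesis by simp
qed

end
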